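(* (Sequence-relevance downward closure.) Let $\mathcal{PD}$ be a finite database of wLAS-sequences and let $T_1, T_2$ be trajectory-patterns with $T_1 \subseteq T_2$. Then $$MSR(T_2) \le MSR(T_1),$$ where for a trajectory-pattern $T$, $MSR(T) = \sum_{\alpha \in \mathcal{PD},\ T \precsim \alpha} \mathcal{R}(\alpha)$.
   Context: Fix a finite set of cells $\mathcal{P}=\{p_1,\dots,p_n\}$ and a finite set $I$ of activities. A wLAS (weighted location-activity-set) is a pair $\alpha_t=(AL_t,AX_t)$ where $AL_t=\{p_{i_1}:w_{i_1},\dots,p_{i_k}:w_{i_k}\}$ is a nonempty set of distinct cells each carrying a weight $w(p_{i_s},\alpha_t)\in(0,1]$, and $AX_t\subseteq I$ is a nonempty activity set. Write $\alpha_t.loc=\{p_{i_1},\dots,p_{i_k}\}$ and $\alpha_t.act=AX_t$. A wLAS-sequence is a finite sequence $\alpha=\langle\alpha_1,\dots,\alpha_m\rangle$ of wLAS; a database $\mathcal{PD}$ is a finite collection of wLAS-sequences. A trajectory-pattern is a sequence $T=\langle (P_1,X_1),\dots,(P_n,X_n)\rangle$ with each $P_i\subseteq\mathcal{P}$ a nonempty set of cells and $X_i\subseteq I$ a nonempty set of activities. For patterns $T_1=\langle (P_i,X_i)\rangle_{i=1}^{n}$ and $T_2=\langle (P'_j,X'_j)\rangle_{j=1}^{q}$, $T_1\subseteq T_2$ means $n\le q$ and there are indices $1\le j_1<\dots<j_n\le q$ with $P_i\subseteq P'_{j_i}$ and $X_i\subseteq X'_{j_i}$ for all $i$. $T$ matches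 $\alpha=\langle\alpha_1,\dots,\alpha_m\rangle$, written $T\precsim\alpha$, if there exist indices $1\le j_1<\dots<j_n\le m$ with $P_i\subseteq\alpha_{j_i}.loc$ and $X_i\subseteq\alpha_{j_i}.act$ for all $i$ (such an index tuple is called a match of $T$ in $\alpha$). Relevance: for a cell $p$ and activity $a$, $\mathcal{R}((p,a),\alpha_t)=w(p,\alpha_t)$ if $p\in\alpha_t.loc$ and $a\in\alpha_t.act$, and $0$ otherwise; for a term $(L,X)$, $\mathcal{R}((L,X),\alpha_t)=\min_{a\in X}\sum_{p\in L}\mathcal{R}((p,a),\alpha_t)$. For a pattern $T$ and a wLAS-sequence $\alpha$, $\mathcal{R}_{\max}(T,\alpha)$ is the maximum of $\sum_{i=1}^n\mathcal{R}((P_i,X_i),\alpha_{j_i})$ over all matches $(j_1,\dots,j_n)$ of $T$ in $\alpha$ (and $0$ if $T\not\precsim\alpha$). The r-pattern of $\alpha=\langle\alpha_1,\dots,\alpha_m\rangle$ is $\langle(\alpha_1.loc,\alpha_1.act),\dots,(\alpha_m.loc,\alpha_m.act)\rangle$, and the sequence-relevance of $\alpha$ is $\mathcal{R}(\alpha)=\mathcal{R}_{\max}(\text{r-pattern of }\alpha,\alpha)$. *)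

theory Defs
  imports Complex_Main "HOL-Library.Multiset"
begin

(* A weighted cell set {p:w, ...} is a partial map from cells to weights; its domain is the
   set of cells that occur in it. *)
type_synonym ('p, 'a) wlas = "('p \<rightharpoonup> real) \<times> 'a set"
type_synonym ('p, 'a) wlas_seq = "('p, 'a) wlas list"
type_synonym ('p, 'a) pattern = "('p set \<times> 'a set) list"

definition loc :: "('p, 'a) wlas \<Rightarrow> 'p set" where
  "loc A = dom (fst A)"

definition act :: "('p, 'a) wlas \<Rightarrow> 'a set" where
  "act A = snd A"

definition weight :: "'p \<Rightarrow> ('p, 'a) wlas \<Rightarrow> real" where
  "weight p A = the (fst A p)"

definition is_wlas :: "'p set \<Rightarrow> 'a set \<Rightarrow> ('p, 'a) wlas \<Rightarrow> bool" where
  "is_wlas Cells I A \<longleftrightarrow>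
     loc A \<noteq> {} \<and> loc A \<subseteq> Cells \<and> (\<forall>p\<in>loc A. 0 < weight p A \<and> weight p A \<le> 1) \<and>
     act A \<noteq> {} \<and> act A \<subseteq> I"

definition is_wlas_seq :: "'p set \<Rightarrow> 'a set \<Rightarrow> ('p, 'a) wlas_seq \<Rightarrow> bool" where
  "is_wlas_seq Cells I \<alpha> \<longleftrightarrow> (\<forall>A\<in>set \<alpha>. is_wlas Cells I A)"

definition is_pattern :: "'p set \<Rightarrow> 'a set \<Rightarrow> ('p, 'a) pattern \<Rightarrow> bool" where
  "is_pattern Cells I T \<longleftrightarrow>
     (\<forall>(P, X)\<in>set T. P \<noteq> {} \<and> P \<subseteq> Cells \<and> X \<noteq> {} \<and> X \<subseteq> I)"

(* Index tuples j_1 < ... < j_n are strictly increasing lists of 0-based positions. *)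
definition subpattern :: "('p, 'a) pattern \<Rightarrow> ('p, 'a) pattern \<Rightarrow> bool" where
  "subpattern T1 T2 \<longleftrightarrow>
     length T1 \<le> length T2 \<and>
     (\<exists>js :: nat list. length js = length T1 \<and> sorted_wrt (<) js \<and>
        (\<forall>i<length T1. js ! i < length T2 \<and>
           fst (T1 ! i) \<subseteq> fst (T2 ! (js ! i)) \<and> snd (T1 ! i) \<subseteq> snd (T2 ! (js ! i))))"

definition is_match :: "('p, 'a) pattern \<Rightarrow> ('p, 'a) wlas_seq \<Rightarrow> nat list \<Rightarrow> bool" where
  "is_match T \<alpha> js \<longleftrightarrow>
     length js = length T \<and> sorted_wrt (<) js \<and>
     (\<forall>i<length T. js ! i < length \<alpha> \<and>
        fst (T ! i) \<subseteq> loc (\<alpha> ! (js ! i)) \<and> snd (T ! i) \<subseteq> act (\<alpha> ! (js ! i)))"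

definition pmatches :: "('p, 'a) pattern \<Rightarrow> ('p, 'a) wlas_seq \<Rightarrow> bool" where
  "pmatches T \<alpha> \<longleftrightarrow> (\<exists>js. is_match T \<alpha> js)"

definition rel_cell :: "'p \<Rightarrow> 'a \<Rightarrow> ('p, 'a) wlas \<Rightarrow> real" where
  "rel_cell p a A = (if p \<in> loc A \<and> a \<in> act A then weight p A else 0)"

definition rel_term :: "'p set \<times> 'a set \<Rightarrow> ('p, 'a) wlas \<Rightarrow> real" where
  "rel_term t A = Min ((\<lambda>a. \<Sum>p\<in>fst t. rel_cell p a A) ` snd t)"

definition rel_max :: "('p, 'a) pattern \<Rightarrow> ('p, 'a) wlas_seq \<Rightarrow> real" where
  "rel_max T \<alpha> =
     (if pmatches T \<alpha>
      then Max {(\<Sum>i<length T. rel_term (T ! i) (\<alpha> ! (js ! i))) | js. is_match T \<alpha> js}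
      else 0)"

definition r_pattern :: "('p, 'a) wlas_seq \<Rightarrow> ('p, 'a) pattern" where
  "r_pattern \<alpha> = map (\<lambda>A. (loc A, act A)) \<alpha>"

definition seq_rel :: "('p, 'a) wlas_seq \<Rightarrow> real" where
  "seq_rel \<alpha> = rel_max (r_pattern \<alpha>) \<alpha>"

(* A database is a multiset, so equal sequences recorded several times all contribute. *)
definition MSR :: "('p, 'a) wlas_seq multiset \<Rightarrow> ('p, 'a) pattern \<Rightarrow> real" where
  "MSR PD T = (\<Sum>\<alpha>\<in>#filter_mset (pmatches T) PD. seq_rel \<alpha>)"

end

theory Submission
  imports Defs
begin

text \<open>
  Matching is transitive along subpatterns, so every sequence matched by the larger pattern is
  matched by the smaller one. Since all sequence-relevances are nonnegative, enlarging the
  collection of matched sequences can only increase their sum.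
\<close>

text \<open>Index tuples compose: if \<open>js\<close> embeds \<open>T1\<close> into
  \<open>T2\<close> and \<open>ks\<close> is a match of \<open>T2\<close> in
  \<open>\<alpha>\<close>, then reading \<open>ks\<close> at the positions \<open>js\<close> gives a
  match of \<open>T1\<close>.\<close>

lemma pmatches_subpattern:
  assumes "subpattern T1 T2" and "pmatches T2 \<alpha>"
  shows "pmatches T1 \<alpha>"
proof -
  obtain js where js: "length js = length T1" "sorted_wrt (<) js"
    "\<And>i. i < length T1 \<Longrightarrow> js ! i < length T2 \<and>
       fst (T1 ! i) \<subseteq> fst (T2 ! (js ! i)) \<and> snd (T1 ! i) \<subseteq> snd (T2 ! (js ! i))"
    using assms(1) unfolding subpattern_def by blast
  obtain ks where ks: "length ks = length T2" "sorted_wrt (<) ks"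
    "\<And>i. i < length T2 \<Longrightarrow> ks ! i < length \<alpha> \<and>
       fst (T2 ! i) \<subseteq> loc (\<alpha> ! (ks ! i)) \<and> snd (T2 ! i) \<subseteq> act (\<alpha> ! (ks ! i))"
    using assms(2) unfolding pmatches_def is_match_def by blast
  \<comment> \<open>Each entry of \<open>js\<close> lies below \<open>length T2\<close>, which is
    also the length of \<open>ks\<close>, so the strict growth of \<open>ks\<close> carries over to
    these positions.\<close>
  have "sorted_wrt (<) (map ((!) ks) js)"
    using js ks(1,2) by (simp add: sorted_wrt_iff_nth_less)
  moreover have "map ((!) ks) js ! i < length \<alpha> \<and>
      fst (T1 ! i) \<subseteq> loc (\<alpha> ! (map ((!) ks) js ! i)) \<and>
      snd (T1 ! i) \<subseteq> act (\<alpha> ! (map ((!) ks) js ! i))" if "i < length T1" for i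
    using js(1) js(3)[OF that] ks(3)[of "js ! i"] that by auto
  ultimately have "is_match T1 \<alpha> (map ((!) ks) js)"
    using js(1) by (simp add: is_match_def)
  then show ?thesis
    unfolding pmatches_def by blast
qed

text \<open>A match is a list of fixed length over finitely many positions. This makes the
  \<open>Max\<close> in \<open>rel_max\<close> range over a finite set, so that it bounds each of
  its elements.\<close>

lemma finite_matches: "finite {js. is_match T \<alpha> js}"
proof (rule finite_subset)
  show "{js. is_match T \<alpha> js} \<subseteq> {js. set js \<subseteq> {..<length \<alpha>} \<and> length js = length T}"
    by (auto simp: is_match_def in_set_conv_nth)
  show "finite {js. set js \<subseteq> {..<length \<alpha>} \<and> length js = length T}"
    by (rule finite_lists_length_eq) simp
qed

text \<open>Weights are positive on \<open>loc A\<close>, and \<open>rel_cell\<close> is 0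
  elsewhere. A finite nonempty \<open>snd t\<close> makes the \<open>Min\<close> an attained
  value.\<close>

lemma rel_term_nonneg:
  assumes "is_wlas Cells I A" and "finite (snd t)" and "snd t \<noteq> {}"
  shows "0 \<le> rel_term t A"
proof -
  have "0 \<le> rel_cell p a A" for p a
    using assms(1) by (auto simp: rel_cell_def is_wlas_def less_imp_le)
  then show ?thesis
    using assms(2,3) by (simp add: rel_term_def sum_nonneg)
qed

text \<open>A single match suffices: its total relevance is nonnegative and bounds the maximum from
  below.\<close>

lemma rel_max_nonneg:
  assumes "is_wlas_seq Cells I \<alpha>" and "\<forall>t\<in>set T. finite (snd t) \<and> snd t \<noteq> {}"
  shows "0 \<le> rel_max T \<alpha>"
proof (cases "pmatches T \<alpha>")
  case True
  let ?S = "{(\<Sum>i<length T. rel_term (T ! i) (\<alpha> ! (js ! i))) | js. is_match T \<alpha> js}"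
  obtain js where js: "is_match T \<alpha> js"
    using True unfolding pmatches_def by blast
  have "0 \<le> (\<Sum>i<length T. rel_term (T ! i) (\<alpha> ! (js ! i)))"
  proof (rule sum_nonneg)
    fix i assume "i \<in> {..<length T}"
    then show "0 \<le> rel_term (T ! i) (\<alpha> ! (js ! i))"
      using js assms by (intro rel_term_nonneg) (auto simp: is_match_def is_wlas_seq_def)
  qed
  also have "\<dots> \<le> Max ?S"
    using js finite_matches[of T \<alpha>] by (intro Max_ge) (auto simp: setcompr_eq_image)
  finally show ?thesis
    using True by (simp add: rel_max_def)
qed (simp add: rel_max_def)

lemma seq_rel_nonneg:
  assumes "is_wlas_seq Cells I \<alpha>" and "finite I"
  shows "0 \<le> seq_rel \<alpha>"
  unfolding seq_rel_def
proof (rule rel_max_nonneg[OF assms(1)])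
  show "\<forall>t\<in>set (r_pattern \<alpha>). finite (snd t) \<and> snd t \<noteq> {}"
    \<comment> \<open>Activity sets inherit finiteness from \<open>I\<close>.\<close>
    using assms by (auto simp: r_pattern_def is_wlas_seq_def is_wlas_def intro: finite_subset)
qed

text \<open>Adding one sequence to \<open>PD\<close> changes neither sum, increases both by the same
  amount, or adds a nonnegative term to the sum for \<open>T1\<close> alone.\<close>

lemma MSR_mono:
  assumes "\<And>\<alpha>. \<alpha> \<in># PD \<Longrightarrow> 0 \<le> seq_rel \<alpha>"
    and "\<And>\<alpha>. \<alpha> \<in># PD \<Longrightarrow> pmatches T2 \<alpha> \<Longrightarrow> pmatches T1 \<alpha>"
  shows "MSR PD T2 \<le> MSR PD T1"
  using assms by (induction PD) (auto simp: MSR_def add_increasing)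

theorem theorem1:
  fixes Cells :: "'p set" and I :: "'a set"
    and PD :: "('p, 'a) wlas_seq multiset"
    and T1 T2 :: "('p, 'a) pattern"
  assumes "finite Cells" and "finite I"
    and "\<forall>\<alpha>\<in>#PD. is_wlas_seq Cells I \<alpha>"
    and "is_pattern Cells I T1" and "is_pattern Cells I T2"
    and "subpattern T1 T2"
  shows "MSR PD T2 \<le> MSR PD T1"
  using assms by (blast intro: MSR_mono seq_rel_nonneg pmatches_subpattern)

end
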